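(* Let $\alpha\in(0,1)$, $\theta\in[\frac{\alpha}{2},\frac12]$ and let $\tau>0$ be arbitrary. Given $\boldsymbol E^0_\tau=\boldsymbol E^0\in H_0(\mathrm{curl};\Omega)$, $H^0_\tau=H^0\in L^2(\Omega)$, $\boldsymbol P^0_\tau=\boldsymbol P^0\in (L^2(\Omega))^2$, let $\boldsymbol E_\tau^n \in H_0(\mathrm{curl};\Omega)$, $H^n_\tau \in L^2(\Omega)$, $\boldsymbol P^n_\tau \in (L^2(\Omega))^2$ ($n\ge 1$) satisfy the semi-discrete scheme $$\epsilon_0 \epsilon_\infty \big(\partial_\tau^{n-\theta} \boldsymbol E_\tau,\boldsymbol\chi\big)+\big(\partial_\tau^{n-\theta} \boldsymbol P_\tau,\boldsymbol\chi\big)-\big(\overline{H}^{n-\theta}_\tau,\nabla \times \boldsymbol\chi\big)=0\quad \forall \boldsymbol\chi \in H_0(\mathrm{curl};\Omega),$$ $$\mu_0 \big(\partial_\tau^{n-\theta} H_\tau,\phi\big)+\big(\nabla \times \overline{\boldsymbol E}_\tau^{n-\theta},\phi\big)=0\quad \forall \phi \in L^2(\Omega),$$ $$\tau_0^\alpha \big(\partial^{\alpha}_\tau \boldsymbol P_\tau^{n-\theta},\boldsymbol\psi\big)+\big(\overline{\boldsymbol P}^{n-\theta}_\tau,\boldsymbol\psi\big)-\epsilon_0(\epsilon_s-\epsilon_\infty) \big(\overline{\boldsymbol E}^{n-\theta}_\tau,\boldsymbol\psi\big)=0\quad \forall \boldsymbol\psi \in (L^2(\Omega))^2.$$ Define,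 for $n\ge0$, $$\widetilde{\mathcal{E}}_\alpha^n:=\tau_0^\alpha\,\mathcal{I}_\tau^{\alpha,\theta} \big\|\partial_\tau^\alpha \boldsymbol P^{n-\theta}_\tau\big\|^2+\|\boldsymbol P^n_\tau\|^2+\epsilon_0(\epsilon_s-\epsilon_\infty)\big(\epsilon_0\epsilon_\infty\|\boldsymbol E^n_\tau\|^2+\mu_0 \|H^n_\tau\|^2\big).$$ Then $$\widetilde{\mathcal{E}}_\alpha^n \leq \widetilde{\mathcal{E}}_\alpha^{n-1}\quad\text{for all } n\geq 1.$$
   Context: $\Omega=(a,b)\times(c,d)\subset\mathbb R^2$ is a bounded rectangle. $(\cdot,\cdot)$ and $\|\cdot\|$ are the $L^2(\Omega)$ (or $(L^2(\Omega))^2$) inner product and norm. $\boldsymbol E_\tau^n$, $\boldsymbol P_\tau^n$ are $\mathbb R^2$-valued and $H_\tau^n$ is scalar. For a vector field $\boldsymbol v=(v_1,v_2)$, $\nabla\times\boldsymbol v=\partial_x v_2-\partial_y v_1$. $H(\mathrm{curl};\Omega)=\{\boldsymbol v\in (L^2(\Omega))^2:\nabla\times\boldsymbol v\in L^2(\Omega)\}$ and $H_0(\mathrm{curl};\Omega)=\{\boldsymbol v\in H(\mathrm{curl};\Omega):\boldsymbol n\times\boldsymbol v=0\text{ on }\partial\Omega\}$, with $\boldsymbol n$ the outward unit normal. The physical constants $\epsilon_0,\epsilon_\infty,\epsilon_s,\mu_0,\tau_0$ are positive with $\epsilon_s>\epsilon_\infty$. For a sequence $(u^n)_{n\ge0}$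 and step size $\tau>0$: $$\partial_\tau^{n-\theta} u:=\frac{u^n-u^{n-1}}{\tau},\qquad \overline{u}^{n-\theta}:=(1-\theta)u^n+\theta u^{n-1},\qquad \partial_\tau^\alpha u^{n-\theta}:=\tau^{-\alpha}\sum_{k=1}^{n}\omega_{n-k}(u^k-u^0),$$ where the weights $\omega_k$ are the power series coefficients of $$\omega(\zeta)=\sum_{k\ge0}\omega_k\zeta^k=\bigg[\frac{1-\zeta}{\frac{1}{2}(1+\zeta)+\frac{\theta}{\alpha}(1-\zeta)}\bigg]^\alpha .$$ In particular $\partial_\tau^\alpha u^{0-\theta}=0$ (empty sum). For a real sequence $(w^n)_{n\ge 0}$, $\mathcal{I}^{\alpha,\theta}_\tau w^{n}:=\tau^\alpha \sum_{k=0}^{n} a_k w^{n-k}$, where the $a_k$ are the power series coefficients of $$a(\zeta)=\sum_{k\ge0}a_k\zeta^k=\frac1{\omega(\zeta)}=(1-\zeta)^{-\alpha}\Big[\tfrac{1}{2}(1+\zeta)+\tfrac{\theta}{\alpha}(1-\zeta)\Big]^\alpha;$$ thus $\mathcal{I}_\tau^{\alpha,\theta} \|\partial_\tau^\alpha \boldsymbol P^{n-\theta}_\tau\|^2=\tau^\alpha\sum_{k=0}^n a_{k}\|\partial_\tau^\alpha \boldsymbol P^{n-k-\theta}_\tau\|^2$. *)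

theory Defs
  imports "HOL-Complex_Analysis.Complex_Analysis"
begin

section \<open>Function spaces\<close>

text \<open>
  Elements of \<open>L\<^sup>2(\<Omega>)\<close> are represented by functions on the whole space; only their values on
  \<open>\<Omega>\<close> matter. All integrals are with respect to Lebesgue measure on \<open>\<Omega>\<close>, and the same definitions
  serve for scalar fields (\<open>'b = real\<close>) and vector fields (\<open>'b = real \<times> real\<close>).
\<close>

definition L2 :: "'a::euclidean_space set \<Rightarrow> ('a \<Rightarrow> 'b::euclidean_space) set" where
  "L2 \<Omega> = {f \<in> borel_measurable (lebesgue_on \<Omega>). integrable (lebesgue_on \<Omega>) (\<lambda>x. (norm (f x))\<^sup>2)}"

definition L2_inner :: "'a::euclidean_space set \<Rightarrow> ('a \<Rightarrow> 'b::euclidean_space) \<Rightarrow> ('a \<Rightarrow> 'b) \<Rightarrow> real" where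
  "L2_inner \<Omega> f g = (LINT x|lebesgue_on \<Omega>. f x \<bullet> g x)"

definition L2_norm :: "'a::euclidean_space set \<Rightarrow> ('a \<Rightarrow> 'b::euclidean_space) \<Rightarrow> real" where
  "L2_norm \<Omega> f = sqrt (L2_inner \<Omega> f f)"

definition pd :: "'a::euclidean_space \<Rightarrow> ('a \<Rightarrow> real) \<Rightarrow> 'a \<Rightarrow> real" where
  "pd e f x = frechet_derivative f (at x) e"

fun C_k :: "nat \<Rightarrow> ('a::euclidean_space \<Rightarrow> real) \<Rightarrow> bool" where
  "C_k 0 f \<longleftrightarrow> continuous_on UNIV f"
| "C_k (Suc k) f \<longleftrightarrow> f differentiable_on UNIV \<and> (\<forall>e\<in>Basis. C_k k (pd e f))"

definition test_functions :: "'a::euclidean_space set \<Rightarrow> ('a \<Rightarrow> real) set" where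
  "test_functions \<Omega> = {\<eta>. (\<forall>k. C_k k \<eta>) \<and> compact (closure {x. \<eta> x \<noteq> 0}) \<and> closure {x. \<eta> x \<noteq> 0} \<subseteq> \<Omega>}"

definition weak_grad :: "'a::euclidean_space set \<Rightarrow> ('a \<Rightarrow> real) \<Rightarrow> ('a \<Rightarrow> 'a) \<Rightarrow> bool" where
  "weak_grad \<Omega> \<phi> g \<longleftrightarrow>
     (\<forall>\<eta>\<in>test_functions \<Omega>. \<forall>e\<in>Basis. L2_inner \<Omega> (\<lambda>x. g x \<bullet> e) \<eta> = - L2_inner \<Omega> \<phi> (pd e \<eta>))"

text \<open>The distributional identity \<open>w = \<partial>\<^sub>x v\<^sub>2 - \<partial>\<^sub>y v\<^sub>1\<close> in \<open>\<Omega>\<close>.\<close>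

definition weak_curl :: "(real \<times> real) set \<Rightarrow> (real \<times> real \<Rightarrow> real \<times> real) \<Rightarrow> (real \<times> real \<Rightarrow> real) \<Rightarrow> bool" where
  "weak_curl \<Omega> v w \<longleftrightarrow>
     (\<forall>\<eta>\<in>test_functions \<Omega>. L2_inner \<Omega> w \<eta> =
        - L2_inner \<Omega> (\<lambda>x. snd (v x)) (pd (1, 0) \<eta>) + L2_inner \<Omega> (\<lambda>x. fst (v x)) (pd (0, 1) \<eta>))"

definition Hcurl :: "(real \<times> real) set \<Rightarrow> (real \<times> real \<Rightarrow> real \<times> real) set" where
  "Hcurl \<Omega> = {v \<in> L2 \<Omega>. \<exists>w\<in>L2 \<Omega>. weak_curl \<Omega> v w}"

text \<open>
  On open \<open>\<Omega>\<close> the weak curl of an element of \<open>Hcurl \<Omega>\<close> is unique up to a null set, so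
  the choice of representative is invisible to \<open>L2_inner\<close>.
\<close>

definition curl :: "(real \<times> real) set \<Rightarrow> (real \<times> real \<Rightarrow> real \<times> real) \<Rightarrow> (real \<times> real \<Rightarrow> real)" where
  "curl \<Omega> v = (SOME w. w \<in> L2 \<Omega> \<and> weak_curl \<Omega> v w)"

text \<open>
  For \<open>v\<close> in \<open>Hcurl \<Omega>\<close> with curl \<open>w\<close>, the tangential trace \<open>n \<times> v = n\<^sub>1 v\<^sub>2 - n\<^sub>2 v\<^sub>1\<close> is an element
  of \<open>H\<^sup>-\<^sup>1\<^sup>/\<^sup>2(\<partial>\<Omega>)\<close>, defined by Green's formula: its value at the boundary trace of \<open>\<phi> \<in> H\<^sup>1(\<Omega>)\<close>
  with gradient \<open>g\<close> is \<open>(w, \<phi>) - (v, (\<partial>\<^sub>y \<phi>, - \<partial>\<^sub>x \<phi>))\<close>.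
\<close>

definition tangential_trace ::
  "(real \<times> real) set \<Rightarrow> (real \<times> real \<Rightarrow> real \<times> real) \<Rightarrow> (real \<times> real \<Rightarrow> real) \<Rightarrow>
   (real \<times> real \<Rightarrow> real) \<Rightarrow> (real \<times> real \<Rightarrow> real \<times> real) \<Rightarrow> real" where
  "tangential_trace \<Omega> v w \<phi> g = L2_inner \<Omega> w \<phi> - L2_inner \<Omega> v (\<lambda>x. (snd (g x), - fst (g x)))"

definition H0curl :: "(real \<times> real) set \<Rightarrow> (real \<times> real \<Rightarrow> real \<times> real) set" where
  "H0curl \<Omega> = {v \<in> L2 \<Omega>. \<exists>w\<in>L2 \<Omega>. weak_curl \<Omega> v w \<and>
     (\<forall>\<phi>\<in>L2 \<Omega>. \<forall>g\<in>L2 \<Omega>. weak_grad \<Omega> \<phi> g \<longrightarrow> tangential_trace \<Omega> v w \<phi> g = 0)}"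

lemma H0curl_subset_Hcurl: "H0curl \<Omega> \<subseteq> Hcurl \<Omega>"
  by (auto simp: H0curl_def Hcurl_def)

section \<open>Convolution quadrature weights\<close>

text \<open>
  The generating functions are taken on the complex plane, with the principal branch of the power.
  They are analytic on the unit disc and real on its real diameter, so \<open>Re\<close> below merely
  converts the (real) Taylor coefficients to type \<open>real\<close>; see \<open>omega_wt_eq\<close> and \<open>a_wt_eq\<close>.
\<close>

definition omega_gen :: "real \<Rightarrow> real \<Rightarrow> complex \<Rightarrow> complex" where
  "omega_gen \<alpha> \<theta> \<zeta> = ((1 - \<zeta>) / (1/2 * (1 + \<zeta>) + of_real (\<theta> / \<alpha>) * (1 - \<zeta>))) powr of_real \<alpha>"

definition omega_wt :: "real \<Rightarrow> real \<Rightarrow> nat \<Rightarrow> real" where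
  "omega_wt \<alpha> \<theta> k = Re (fps_nth (fps_expansion (omega_gen \<alpha> \<theta>) 0) k)"

definition a_wt :: "real \<Rightarrow> real \<Rightarrow> nat \<Rightarrow> real" where
  "a_wt \<alpha> \<theta> k = Re (fps_nth (fps_expansion (\<lambda>\<zeta>. 1 / omega_gen \<alpha> \<theta> \<zeta>) 0) k)"

lemma omega_base_Re_pos:
  fixes \<zeta> :: complex
  assumes "norm \<zeta> < 1" "0 \<le> c"
  shows "Re ((1 - \<zeta>) / (1/2 * (1 + \<zeta>) + of_real c * (1 - \<zeta>))) > 0"
proof -
  have nz: "1 - \<zeta> \<noteq> 0" using assms(1) by auto
  define u where "u = of_real c + (1 + \<zeta>) / (1 - \<zeta>) / 2"
  have lt: "(Re \<zeta>)\<^sup>2 + (Im \<zeta>)\<^sup>2 < 1"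
    using assms(1) by (simp add: cmod_def)
  have "Re ((1 + \<zeta>) / (1 - \<zeta>)) = (1 - ((Re \<zeta>)\<^sup>2 + (Im \<zeta>)\<^sup>2)) / (norm (1 - \<zeta>))\<^sup>2"
    by (simp add: Re_divide cmod_power2) (simp add: power2_eq_square algebra_simps)
  also have "\<dots> > 0"
    using lt nz by (intro divide_pos_pos) auto
  finally have "Re ((1 + \<zeta>) / (1 - \<zeta>)) > 0" .
  then have u: "Re u > 0" using assms(2) by (simp add: u_def del: divide_divide_eq_left)
  have "1/2 * (1 + \<zeta>) + of_real c * (1 - \<zeta>) = u * (1 - \<zeta>)"
    using nz by (simp add: u_def field_simps)
  then have "(1 - \<zeta>) / (1/2 * (1 + \<zeta>) + of_real c * (1 - \<zeta>)) = inverse u"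
    using nz by (simp add: divide_simps)
  moreover have "Re (inverse u) > 0"
    using u by (simp add: sum_power2_gt_zero_iff)
  ultimately show ?thesis by simp
qed

lemma omega_gen_holomorphic:
  assumes "0 < \<alpha>" "0 \<le> \<theta>"
  shows "omega_gen \<alpha> \<theta> holomorphic_on ball 0 1"
proof -
  have pos: "Re ((1 - \<zeta>) / (1/2 * (1 + \<zeta>) + of_real (\<theta> / \<alpha>) * (1 - \<zeta>))) > 0"
    if "\<zeta> \<in> ball 0 1" for \<zeta> :: complex
    using omega_base_Re_pos[of \<zeta> "\<theta> / \<alpha>"] that assms by simp
  have nz: "1/2 * (1 + \<zeta>) + of_real (\<theta> / \<alpha>) * (1 - \<zeta>) \<noteq> 0" if "\<zeta> \<in> ball 0 1" for \<zeta> :: complex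
    using pos[OF that] by (metis div_by_0 less_irrefl zero_complex.sel(1))
  show ?thesis
    unfolding omega_gen_def
    by (intro holomorphic_intros) (use pos nz in \<open>force simp: complex_nonpos_Reals_iff\<close>)+
qed

lemma omega_gen_nonzero:
  assumes "0 < \<alpha>" "0 \<le> \<theta>" "norm \<zeta> < 1"
  shows "omega_gen \<alpha> \<theta> \<zeta> \<noteq> 0"
  using omega_base_Re_pos[of \<zeta> "\<theta> / \<alpha>"] assms by (force simp: omega_gen_def)

lemma omega_gen_expansion:
  assumes "0 < \<alpha>" "0 \<le> \<theta>"
  shows "omega_gen \<alpha> \<theta> has_fps_expansion fps_expansion (omega_gen \<alpha> \<theta>) 0"
    and "(\<lambda>\<zeta>. 1 / omega_gen \<alpha> \<theta> \<zeta>) has_fps_expansion fps_expansion (\<lambda>\<zeta>. 1 / omega_gen \<alpha> \<theta> \<zeta>) 0"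
  by (rule has_fps_expansion_fps_expansion[of "ball 0 1"];
      (auto intro!: holomorphic_intros omega_gen_holomorphic assms simp: omega_gen_nonzero assms))+

lemma omega_gen_cnj:
  assumes "0 < \<alpha>" "0 \<le> \<theta>" "norm \<zeta> < 1"
  shows "omega_gen \<alpha> \<theta> (cnj \<zeta>) = cnj (omega_gen \<alpha> \<theta> \<zeta>)"
proof -
  have "(1 - \<zeta>) / (1/2 * (1 + \<zeta>) + of_real (\<theta> / \<alpha>) * (1 - \<zeta>)) \<notin> \<real>\<^sub>\<le>\<^sub>0"
    using omega_base_Re_pos[of \<zeta> "\<theta> / \<alpha>"] assms by (force simp: complex_nonpos_Reals_iff)
  then show ?thesis
    unfolding omega_gen_def by (subst cnj_powr) (auto simp: complex_nonpos_Reals_iff complex_is_Real_iff)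
qed

lemma fps_expansion_coeff_real:
  assumes f: "f has_fps_expansion F" and cnj: "\<And>z. norm z < 1 \<Longrightarrow> f (cnj z) = cnj (f z)"
  shows "fps_nth F k \<in> \<real>"
proof -
  define G where "G = Abs_fps (\<lambda>n. cnj (fps_nth F n))"
  have r: "fps_conv_radius G = fps_conv_radius F"
    unfolding fps_conv_radius_def conv_radius_def by (simp add: G_def)
  have ev: "eval_fps G z = cnj (eval_fps F (cnj z))" if "ereal (norm z) < fps_conv_radius F" for z
  proof -
    have "(\<lambda>n. fps_nth F n * cnj z ^ n) sums eval_fps F (cnj z)"
      using that by (intro sums_eval_fps) simp
    then have "(\<lambda>n. cnj (fps_nth F n * cnj z ^ n)) sums cnj (eval_fps F (cnj z))"
      by (simp only: sums_cnj)
    then show ?thesis by (simp add: eval_fps_def G_def sums_iff)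
  qed
  have "continuous (at (0::complex)) cnj" by (intro continuous_intros)
  then have lim: "filterlim cnj (nhds (0::complex)) (nhds 0)"
    by (simp add: continuous_at tendsto_nhds_iff isCont_def)
  have e1: "\<forall>\<^sub>F z in nhds 0. eval_fps F (cnj z) = f (cnj z)"
    using f by (intro eventually_compose_filterlim[OF _ lim]) (auto simp: has_fps_expansion_def)
  have e2: "\<forall>\<^sub>F z in nhds 0. z \<in> eball (0::complex) (fps_conv_radius F)"
    using f by (intro eventually_nhds_in_open) (auto simp: has_fps_expansion_def zero_ereal_def)
  have e3: "\<forall>\<^sub>F z in nhds 0. z \<in> ball (0::complex) 1"
    by (intro eventually_nhds_in_open) auto
  have "\<forall>\<^sub>F z in nhds 0. eval_fps G z = f z"
    using e1 e2 e3 by eventually_elim (simp add: ev cnj)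
  then have "f has_fps_expansion G"
    using f r by (simp add: has_fps_expansion_def)
  then have "fps_nth G k = fps_nth F k"
    using f by (simp add: fps_nth_fps_expansion)
  then show ?thesis by (simp add: G_def Reals_cnj_iff)
qed

lemma omega_wt_eq:
  assumes "0 < \<alpha>" "0 \<le> \<theta>"
  shows "of_real (omega_wt \<alpha> \<theta> k) = fps_nth (fps_expansion (omega_gen \<alpha> \<theta>) 0) k"
  using fps_expansion_coeff_real[OF omega_gen_expansion(1)[OF assms]] omega_gen_cnj[OF assms]
  by (simp add: omega_wt_def of_real_Re)

lemma a_wt_eq:
  assumes "0 < \<alpha>" "0 \<le> \<theta>"
  shows "of_real (a_wt \<alpha> \<theta> k) = fps_nth (fps_expansion (\<lambda>\<zeta>. 1 / omega_gen \<alpha> \<theta> \<zeta>) 0) k"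
  using fps_expansion_coeff_real[OF omega_gen_expansion(2)[OF assms]] omega_gen_cnj[OF assms]
  by (simp add: a_wt_def of_real_Re)

section \<open>Discrete operators\<close>

text \<open>
  The first two are used for \<open>n \<ge> 1\<close> only. The superscript \<open>n - \<theta>\<close> is notation for the time level;
  \<open>\<partial>\<^sub>\<tau>\<^sup>n\<^sup>-\<^sup>\<theta> u\<close> itself does not depend on \<open>\<theta>\<close>.
\<close>

definition diff_quot :: "real \<Rightarrow> (nat \<Rightarrow> 'a \<Rightarrow> 'b::real_vector) \<Rightarrow> nat \<Rightarrow> 'a \<Rightarrow> 'b" where
  "diff_quot \<tau> u n = (\<lambda>x. (u n x - u (n - 1) x) /\<^sub>R \<tau>)"

definition theta_avg :: "real \<Rightarrow> (nat \<Rightarrow> 'a \<Rightarrow> 'b::real_vector) \<Rightarrow> nat \<Rightarrow> 'a \<Rightarrow> 'b" where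
  "theta_avg \<theta> u n = (\<lambda>x. (1 - \<theta>) *\<^sub>R u n x + \<theta> *\<^sub>R u (n - 1) x)"

definition frac_diff :: "real \<Rightarrow> real \<Rightarrow> real \<Rightarrow> (nat \<Rightarrow> 'a \<Rightarrow> 'b::real_vector) \<Rightarrow> nat \<Rightarrow> 'a \<Rightarrow> 'b" where
  "frac_diff \<alpha> \<theta> \<tau> u n =
     (\<lambda>x. (\<tau> powr (- \<alpha>)) *\<^sub>R (\<Sum>k = 1..n. omega_wt \<alpha> \<theta> (n - k) *\<^sub>R (u k x - u 0 x)))"

definition frac_int :: "real \<Rightarrow> real \<Rightarrow> real \<Rightarrow> (nat \<Rightarrow> real) \<Rightarrow> nat \<Rightarrow> real" where
  "frac_int \<alpha> \<theta> \<tau> w n = \<tau> powr \<alpha> * (\<Sum>k = 0..n. a_wt \<alpha> \<theta> k * w (n - k))"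

definition energy ::
  "(real \<times> real) set \<Rightarrow> real \<Rightarrow> real \<Rightarrow> real \<Rightarrow> real \<Rightarrow> real \<Rightarrow> real \<Rightarrow> real \<Rightarrow> real \<Rightarrow>
   (nat \<Rightarrow> real \<times> real \<Rightarrow> real \<times> real) \<Rightarrow> (nat \<Rightarrow> real \<times> real \<Rightarrow> real) \<Rightarrow>
   (nat \<Rightarrow> real \<times> real \<Rightarrow> real \<times> real) \<Rightarrow> nat \<Rightarrow> real" where
  "energy \<Omega> \<alpha> \<theta> \<tau> \<epsilon>\<^sub>0 \<epsilon>\<^sub>i\<^sub>n\<^sub>f \<epsilon>\<^sub>s \<mu>\<^sub>0 \<tau>\<^sub>0 E H P n =
     \<tau>\<^sub>0 powr \<alpha> * frac_int \<alpha> \<theta> \<tau> (\<lambda>m. (L2_norm \<Omega> (frac_diff \<alpha> \<theta> \<tau> P m))\<^sup>2) n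
     + (L2_norm \<Omega> (P n))\<^sup>2
     + \<epsilon>\<^sub>0 * (\<epsilon>\<^sub>s - \<epsilon>\<^sub>i\<^sub>n\<^sub>f) * (\<epsilon>\<^sub>0 * \<epsilon>\<^sub>i\<^sub>n\<^sub>f * (L2_norm \<Omega> (E n))\<^sup>2 + \<mu>\<^sub>0 * (L2_norm \<Omega> (H n))\<^sup>2)"

end

theory Submission
  imports Defs
begin

text \<open>
  Testing the first equation of the scheme with \<open>theta_avg \<theta> E n\<close>, the second with
  \<open>theta_avg \<theta> H n\<close> and the third with \<open>diff_quot \<tau> P n\<close> makes the two curl terms cancel, and the
  coupling between \<open>E\<close> and \<open>P\<close> cancels as well once the first two equations are scaled by
  \<open>\<epsilon>\<^sub>0 (\<epsilon>\<^sub>s - \<epsilon>\<^sub>i\<^sub>n\<^sub>f)\<close>. Writing \<open>u'\<close> for the difference quotient of \<open>u\<close>, \<open>\<langle>u\<rangle>\<close> for its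
  \<open>\<theta>\<close>-average and \<open>V\<^sup>n\<close> for the fractional difference of \<open>P\<close>, what remains is
  \<open>\<tau>\<^sub>0\<^sup>\<alpha> (V\<^sup>n, P') + (P', \<langle>P\<rangle>) + \<epsilon>\<^sub>0 (\<epsilon>\<^sub>s - \<epsilon>\<^sub>i\<^sub>n\<^sub>f) (\<epsilon>\<^sub>0 \<epsilon>\<^sub>i\<^sub>n\<^sub>f (E', \<langle>E\<rangle>) + \<mu>\<^sub>0 (H', \<langle>H\<rangle>)) = 0\<close>.
  The energy decreases because \<open>2 \<tau>\<close> times each of these products dominates the increment of the
  corresponding part of the energy.

  For the products \<open>(u', \<langle>u\<rangle>)\<close> this is the polarisation identity together with \<open>\<theta> \<le> 1/2\<close>
  (\<open>theta_avg_energy\<close>). For the memory term (\<open>frac_int_energy\<close>) the fractional difference is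
  inverted: since the weights \<open>a\<close> have the generating function \<open>1 / \<omega>\<close>, the increment of \<open>P\<close> is
  \<open>P\<^sup>n - P\<^sup>n\<^sup>-\<^sup>1 = \<tau>\<^sup>\<alpha> \<Sum>\<^sub>k b\<^sub>k V\<^sup>n\<^sup>-\<^sup>k\<close>, where \<open>b\<close> is the backward difference of \<open>a\<close>, and the increment of
  the fractional integral is the same convolution applied to \<open>\<parallel>V\<^sup>n\<^sup>-\<^sup>k\<parallel>\<^sup>2\<close>. If \<open>a\<close> is nonnegative
  and decreasing, then \<open>b\<^sub>k \<le> 0\<close> for \<open>k \<ge> 1\<close> while the partial sums of \<open>b\<close> are nonnegative, and
  the elementary inequality \<open>2 x \<bullet> y - y \<bullet> y \<le> x \<bullet> x\<close> gives the claim pointwise in \<open>\<Omega>\<close>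
  (\<open>convolution_inner_ge\<close>).

  The monotonicity of \<open>a\<close> (\<open>a_wt_nonneg_decreasing\<close>) is the core of the argument and is where
  \<open>\<alpha>/2 \<le> \<theta>\<close> enters. With \<open>c = \<theta>/\<alpha>\<close>, the generating function \<open>a\<close> solves the differential equation
  \<open>(1 - \<zeta>) (1/2 + c + (1/2 - c) \<zeta>) a' = \<alpha> a\<close>, which yields a three-term recurrence for the weights.
  One term of it has the unfavourable sign; it is absorbed by propagating a lower bound on the
  ratio of consecutive terms (\<open>three_term_recurrence_nonneg\<close>). The differences \<open>a\<^sub>n - a\<^sub>n\<^sub>+\<^sub>1\<close> satisfy
  a recurrence of the same shape.
\<close>

section \<open>Monotonicity of the weights\<close>

text \<open>
  Nonnegativity alone does not propagate, because of the term \<open>- r n x\<^sub>n\<close>. The stronger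
  statement \<open>r x\<^sub>n \<le> x\<^sub>n\<^sub>+\<^sub>1\<close> does: it bounds the loss by \<open>n x\<^sub>n\<^sub>+\<^sub>1\<close>, which leaves \<open>x\<^sub>n\<^sub>+\<^sub>1\<close> with the
  coefficient \<open>r n + q \<ge> r (n + p)\<close>. For the weights, \<open>1\<close> and \<open>1 / r\<close> are the singularities of
  the generating function, and such a ratio bound holds for the moments of any positive measure
  on \<open>[r, 1]\<close>.
\<close>

lemma three_term_recurrence_nonneg:
  fixes x :: "nat \<Rightarrow> real"
  assumes "0 \<le> x 0" "0 \<le> x 1" "0 \<le> r" "0 < p" "r * p \<le> q"
    and rec: "\<And>n. (real n + p) * x (n + 2) = ((1 + r) * real n + q) * x (n + 1) - r * real n * x n"
  shows "0 \<le> x n"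
proof -
  \<comment> \<open>The factor \<open>n\<close> waives the ratio bound at \<open>n = 0\<close>, where it may fail and where the recurrence
    gives \<open>x 0\<close> no weight.\<close>
  have "0 \<le> x n \<and> 0 \<le> x (n + 1) \<and> real n * (r * x n) \<le> real n * x (n + 1)"
  proof (induction n)
    case 0
    then show ?case using assms by simp
  next
    case (Suc n)
    have "(real n + p) * (r * x (n + 1)) = (r * real n + r * p) * x (n + 1)"
      by (simp add: algebra_simps)
    also have "\<dots> \<le> (r * real n + q) * x (n + 1)"
      using Suc assms(5) by (intro mult_right_mono) auto
    also have "\<dots> = ((1 + r) * real n + q) * x (n + 1) - real n * x (n + 1)"
      by (simp add: algebra_simps)
    also have "\<dots> \<le> (real n + p) * x (n + 2)"
      using Suc unfolding rec by (simp add: algebra_simps)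
    finally have "r * x (n + 1) \<le> x (n + 2)"
      using assms(4) by (subst (asm) mult_le_cancel_left_pos) auto
    then show ?case
      using Suc assms(3) by (auto intro!: mult_left_mono intro: order_trans[OF mult_nonneg_nonneg])
  qed
  then show ?thesis by simp
qed

text \<open>
  The recurrence is the one obeyed by the Taylor coefficients of
  \<open>C (1 - \<zeta>)\<^sup>-\<^sup>\<alpha> (1 - r \<zeta>)\<^sup>\<alpha>\<close>. Multiplying this function by \<open>1 - \<zeta>\<close> produces a solution of
  an equation of the same type, so the differences of consecutive coefficients fall under the
  same criterion, with \<open>p = 3\<close> in place of \<open>p = 2\<close>.
\<close>

lemma recurrence_nonneg_decreasing:
  fixes a :: "nat \<Rightarrow> real"
  assumes \<alpha>: "0 < \<alpha>" "\<alpha> < 1" and r: "0 \<le> r" "r < 1" and a0: "0 \<le> a 0"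
    and rec0: "a 1 = \<alpha> * (1 - r) * a 0"
    and rec: "\<And>n. (real n + 2) * a (n + 2)
                = ((1 + r) * (real n + 1) + \<alpha> * (1 - r)) * a (n + 1) - r * real n * a n"
  shows "0 \<le> a n" and "a (Suc n) \<le> a n"
proof -
  define \<kappa> where "\<kappa> = \<alpha> * (1 - r)"
  have \<kappa>: "0 < \<kappa>" "\<kappa> < 1 - r"
    using \<alpha> r by (auto simp: \<kappa>_def)
  have a1: "0 \<le> a 1"
    using a0 \<kappa> rec0 by (simp add: \<kappa>_def)
  show "0 \<le> a n"
  proof (rule three_term_recurrence_nonneg[where p = 2 and q = "1 + r + \<kappa>"])
    show "(real n + 2) * a (n + 2) = ((1 + r) * real n + (1 + r + \<kappa>)) * a (n + 1) - r * real n * a n" for n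
      unfolding rec by (simp add: \<kappa>_def algebra_simps)
  qed (use a0 a1 r \<kappa> in auto)
  define x where "x n = a n - a (Suc n)" for n
  have "0 \<le> x n"
  proof (rule three_term_recurrence_nonneg[where p = 3 and q = "1 + 2 * r + \<kappa>"])
    show "0 \<le> x 0"
      using mult_right_mono[of \<kappa> 1 "a 0"] \<kappa> r a0 rec0 unfolding \<kappa>_def[symmetric] by (simp add: x_def)
    have "2 * x 1 = (1 - r - \<kappa>) * a 1"
      using rec[of 0] by (simp add: x_def \<kappa>_def algebra_simps numeral_2_eq_2)
    moreover have "\<dots> \<ge> 0"
      using \<kappa> a1 by simp
    ultimately show "0 \<le> x 1" by simp
    \<comment> \<open>The difference of the recurrences at \<open>n\<close> and at \<open>n + 1\<close>.\<close>
    show "(real n + 3) * x (n + 2) = ((1 + r) * real n + (1 + 2 * r + \<kappa>)) * x (n + 1) - r * real n * x n" for n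
      using rec[of n] rec[of "Suc n"] by (simp add: x_def \<kappa>_def algebra_simps)
  qed (use r \<kappa> in auto)
  then show "a (Suc n) \<le> a n" by (simp add: x_def)
qed

text \<open>
  The base \<open>w = (1 - \<zeta>) / u\<close> with \<open>u = 1/2 + c + (1/2 - c) \<zeta>\<close> has the derivative \<open>- 1 / u\<^sup>2\<close>,
  so that \<open>w' / w = - 1 / ((1 - \<zeta>) u)\<close>; hence \<open>w\<^sup>-\<^sup>\<alpha>\<close> satisfies a linear equation with polynomial
  coefficients, which passes to its Taylor series.
\<close>

lemma a_wt_generating_ode:
  assumes "0 < \<alpha>" "0 \<le> \<theta>"
  defines "F \<equiv> fps_expansion (\<lambda>\<zeta>. 1 / omega_gen \<alpha> \<theta> \<zeta>) 0"
  defines "c \<equiv> complex_of_real (\<theta> / \<alpha>)"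
  shows "(1 - fps_X) * (fps_const (1/2 + c) + fps_const (1/2 - c) * fps_X) * fps_deriv F
           = fps_const (of_real \<alpha>) * F"
proof -
  define f where "f = (\<lambda>\<zeta>. 1 / omega_gen \<alpha> \<theta> \<zeta>)"
  have f: "f has_fps_expansion F"
    unfolding f_def F_def by (rule omega_gen_expansion) fact+
  have ode: "(1 - \<zeta>) * (1/2 + c + (1/2 - c) * \<zeta>) * deriv f \<zeta> = of_real \<alpha> * f \<zeta>"
    if \<zeta>: "\<zeta> \<in> ball 0 1" for \<zeta>
  proof -
    define w :: "complex \<Rightarrow> complex" where "w = (\<lambda>z. (1 - z) / (1/2 * (1 + z) + c * (1 - z)))"
    have pos: "Re (w \<zeta>) > 0"
      unfolding w_def c_def using omega_base_Re_pos[of \<zeta> "\<theta> / \<alpha>"] \<zeta> assms by simp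
    define u where "u = 1/2 * (1 + \<zeta>) + c * (1 - \<zeta>)"
    have u: "u \<noteq> 0" 
      using pos unfolding u_def w_def by (metis div_by_0 less_irrefl zero_complex.sel(1))
    have u_alt: "u = 1/2 + c + (1/2 - c) * \<zeta>"
      by (simp add: u_def algebra_simps add_divide_distrib)
    have w\<zeta>: "w \<zeta> = (1 - \<zeta>) / u" by (simp add: w_def u_def)
    have nz: "w \<zeta> \<noteq> 0" "1 - \<zeta> \<noteq> 0" using pos w\<zeta> by auto
    have w': "(w has_field_derivative (- 1 / u\<^sup>2)) (at \<zeta>)"
      unfolding w_def using u unfolding u_def
      by (auto intro!: derivative_eq_intros simp: field_simps power2_eq_square)
    have om: "omega_gen \<alpha> \<theta> = (\<lambda>z. w z powr of_real \<alpha>)"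
      by (simp add: omega_gen_def w_def c_def fun_eq_iff)
    have "(f has_field_derivative (of_real \<alpha> * f \<zeta> / ((1 - \<zeta>) * u))) (at \<zeta>)"
      unfolding f_def om using pos nz u
      by (auto intro!: derivative_eq_intros w' simp: complex_nonpos_Reals_iff powr_diff w\<zeta>)
         (simp add: field_simps power2_eq_square)
    then have "deriv f \<zeta> = of_real \<alpha> * f \<zeta> / ((1 - \<zeta>) * u)" by (rule DERIV_imp_deriv)
    then show ?thesis using u nz by (simp add: u_alt)
  qed
  have "(\<lambda>\<zeta>. (1 - \<zeta>) * (1/2 + c + (1/2 - c) * \<zeta>) * deriv f \<zeta>) has_fps_expansion
         (1 - fps_X) * (fps_const (1/2 + c) + fps_const (1/2 - c) * fps_X) * fps_deriv F"
    by (intro fps_expansion_intros f)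
  moreover have rhs: "(\<lambda>\<zeta>. of_real \<alpha> * f \<zeta>) has_fps_expansion fps_const (of_real \<alpha>) * F"
    by (intro fps_expansion_intros f)
  moreover have "eventually (\<lambda>\<zeta>. \<zeta> \<in> ball (0::complex) 1) (nhds 0)"
    by (intro eventually_nhds_in_open) auto
  then have "\<forall>\<^sub>F \<zeta> in nhds 0. (1 - \<zeta>) * (1/2 + c + (1/2 - c) * \<zeta>) * deriv f \<zeta> = of_real \<alpha> * f \<zeta>"
    by eventually_elim (rule ode)
  ultimately have "(\<lambda>\<zeta>. of_real \<alpha> * f \<zeta>) has_fps_expansion
         (1 - fps_X) * (fps_const (1/2 + c) + fps_const (1/2 - c) * fps_X) * fps_deriv F"
    using has_fps_expansion_cong[OF _ refl] by fast
  then show ?thesis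
    using rhs by (rule fps_expansion_unique_complex)
qed

lemma a_wt_0_nonneg: "0 \<le> a_wt \<alpha> \<theta> 0" if "0 < \<alpha>" "0 \<le> \<theta>"
proof -
  define x where "x = 1 / (1/2 + \<theta> / \<alpha>)"
  have "x > 0" using that by (auto simp: x_def intro!: add_pos_nonneg)
  have "omega_gen \<alpha> \<theta> 0 = of_real x powr of_real \<alpha>"
    by (simp add: omega_gen_def x_def)
  also have "\<dots> = of_real (x powr \<alpha>)"
    using \<open>x > 0\<close> by (simp add: powr_of_real)
  finally show ?thesis
    by (simp add: a_wt_def fps_expansion_def)
qed

text \<open>
  Comparing coefficients in the differential equation and dividing by \<open>1/2 + c\<close> gives the
  recurrence above with \<open>r = (c - 1/2) / (c + 1/2)\<close>. The bound \<open>\<alpha> / 2 \<le> \<theta>\<close> says exactly that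
  \<open>r \<ge> 0\<close>.
\<close>

lemma a_wt_nonneg_decreasing:
  assumes "0 < \<alpha>" "\<alpha> < 1" "\<alpha> / 2 \<le> \<theta>"
  shows "0 \<le> a_wt \<alpha> \<theta> n" and "a_wt \<alpha> \<theta> (Suc n) \<le> a_wt \<alpha> \<theta> n"
proof -
  have \<theta>: "0 \<le> \<theta>" using assms by simp
  define c where "c = \<theta> / \<alpha>"
  have c: "1/2 \<le> c" using assms by (simp add: c_def field_simps)
  define F where "F = fps_expansion (\<lambda>\<zeta>. 1 / omega_gen \<alpha> \<theta> \<zeta>) 0"
  have F: "fps_nth F n = of_real (a_wt \<alpha> \<theta> n)" for n
    unfolding F_def using a_wt_eq assms \<theta> by simp
  \<comment> \<open>The expanded form makes the coefficients of both sides accessible to simplification.\<close>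
  have ode: "fps_const (of_real (1/2 + c)) * fps_deriv F - fps_const (of_real (2 * c)) * (fps_X * fps_deriv F)
     + fps_const (of_real (c - 1/2)) * (fps_X * (fps_X * fps_deriv F)) = fps_const (of_real \<alpha>) * F"
    (is "?L = _")
  proof -
    have "fps_const (of_real (2 * c)) = fps_const (1/2 + complex_of_real c) - fps_const (1/2 - complex_of_real c)"
      by simp
    moreover have "fps_const (of_real (c - 1/2)) = - fps_const (1/2 - complex_of_real c)"
      by simp
    ultimately have "?L = (1 - fps_X) * (fps_const (1/2 + of_real c) + fps_const (1/2 - of_real c) * fps_X) * fps_deriv F"
      by (simp only: of_real_add of_real_divide of_real_1 of_real_numeral) (simp add: algebra_simps del: fps_const_sub fps_const_neg fps_const_add)
    then show ?thesis
      using a_wt_generating_ode[OF assms(1) \<theta>] by (simp add: F_def c_def)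
  qed
  have rec0: "(1/2 + c) * a_wt \<alpha> \<theta> 1 = \<alpha> * a_wt \<alpha> \<theta> 0"
    using arg_cong[OF ode, of "\<lambda>f. Re (fps_nth f 0)"] by (simp add: F)
  have rec: "(1/2 + c) * ((real n + 2) * a_wt \<alpha> \<theta> (n + 2)) - 2 * c * ((real n + 1) * a_wt \<alpha> \<theta> (n + 1))
      + (c - 1/2) * (real n * a_wt \<alpha> \<theta> n) = \<alpha> * a_wt \<alpha> \<theta> (n + 1)" for n
    using arg_cong[OF ode, of "\<lambda>f. Re (fps_nth f (Suc n))"]
    by (cases n) (simp_all add: F algebra_simps)
  define r where "r = (c - 1/2) / (c + 1/2)"
  have r: "0 \<le> r" "r < 1" using c by (auto simp: r_def)
  have rc: "(1/2 + c) * r = c - 1/2" "(1/2 + c) * (1 - r) = 1" 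
    using c by (auto simp: r_def field_simps)
  have cpos: "1/2 + c \<noteq> 0" using c by simp
  have e0: "a_wt \<alpha> \<theta> 1 = \<alpha> * (1 - r) * a_wt \<alpha> \<theta> 0"
  proof -
    have "(1/2 + c) * a_wt \<alpha> \<theta> 1 = (1/2 + c) * (\<alpha> * (1 - r) * a_wt \<alpha> \<theta> 0)"
      using rec0 rc(2) by algebra
    then show ?thesis using cpos by simp
  qed
  have e: "(real n + 2) * a_wt \<alpha> \<theta> (n + 2) = ((1 + r) * (real n + 1) + \<alpha> * (1 - r)) * a_wt \<alpha> \<theta> (n + 1)
     - r * real n * a_wt \<alpha> \<theta> n" for n
  proof -
    have "(1/2 + c) * ((real n + 2) * a_wt \<alpha> \<theta> (n + 2)) = (1/2 + c) * (((1 + r) * (real n + 1) + \<alpha> * (1 - r)) * a_wt \<alpha> \<theta> (n + 1)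
     - r * real n * a_wt \<alpha> \<theta> n)"
    proof -
      have *: "A * (((1 + r) * (real n + 1) + \<alpha> * (1 - r)) * y - r * real n * z)
        = ((A + A * r) * (real n + 1) + \<alpha> * (A * (1 - r))) * y - A * r * (real n * z)" for A y z
        by (simp add: algebra_simps)
      show ?thesis
        unfolding * rc using rec[of n] by (simp add: algebra_simps)
    qed
    then show ?thesis using cpos by simp
  qed
  note * = recurrence_nonneg_decreasing[where a = "a_wt \<alpha> \<theta>", OF assms(1,2) r a_wt_0_nonneg[OF assms(1) \<theta>] e0 e]
  show "0 \<le> a_wt \<alpha> \<theta> n" by (rule *(1))
  show "a_wt \<alpha> \<theta> (Suc n) \<le> a_wt \<alpha> \<theta> n" by (rule *(2))
qed

section \<open>Discrete convolutions\<close>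

lemma a_wt_omega_wt_inverse:
  assumes "0 < \<alpha>" "0 \<le> \<theta>"
  shows "(\<Sum>i\<le>n. a_wt \<alpha> \<theta> i * omega_wt \<alpha> \<theta> (n - i)) = (if n = 0 then 1 else 0)"
proof -
  define F G where "F = fps_expansion (\<lambda>\<zeta>. 1 / omega_gen \<alpha> \<theta> \<zeta>) 0" and "G = fps_expansion (omega_gen \<alpha> \<theta>) 0"
  have FG: "(\<lambda>\<zeta>. 1 / omega_gen \<alpha> \<theta> \<zeta> * omega_gen \<alpha> \<theta> \<zeta>) has_fps_expansion F * G"
    unfolding F_def G_def by (intro fps_expansion_intros omega_gen_expansion assms)
  have "eventually (\<lambda>\<zeta>. \<zeta> \<in> ball (0::complex) 1) (nhds 0)"
    by (intro eventually_nhds_in_open) auto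
  then have "\<forall>\<^sub>F \<zeta> in nhds 0. 1 / omega_gen \<alpha> \<theta> \<zeta> * omega_gen \<alpha> \<theta> \<zeta> = 1"
    by eventually_elim (use omega_gen_nonzero[OF assms] in auto)
  then have "(\<lambda>\<zeta>. 1) has_fps_expansion F * G"
    using FG has_fps_expansion_cong[OF _ refl] by fast
  then have "F * G = 1"
    using has_fps_expansion_1 by (rule fps_expansion_unique_complex)
  then have "fps_nth (F * G) n = (if n = 0 then 1 else 0)" by simp
  then have "complex_of_real (\<Sum>i\<le>n. a_wt \<alpha> \<theta> i * omega_wt \<alpha> \<theta> (n - i)) = of_real (if n = 0 then 1 else 0)"
    by (simp add: fps_mult_nth F_def G_def a_wt_eq[OF assms] omega_wt_eq[OF assms] atMost_atLeast0)
  then show ?thesis by (simp only: of_real_eq_iff)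
qed

lemma convolution_inverse:
  fixes u :: "nat \<Rightarrow> 'b::real_vector"
  assumes inv: "\<And>n. (\<Sum>i\<le>n. a i * w (n - i)) = (if n = 0 then 1 else 0 :: real)"
  shows "(\<Sum>k\<le>n. a k *\<^sub>R (\<Sum>j\<le>n - k. w (n - k - j) *\<^sub>R u j)) = u n"
proof -
  have "(\<Sum>k\<le>n. a k *\<^sub>R (\<Sum>j\<le>n - k. w (n - k - j) *\<^sub>R u j))
      = (\<Sum>(k, j)\<in>Sigma {..n} (\<lambda>k. {..n - k}). (a k * w (n - k - j)) *\<^sub>R u j)"
    by (simp add: scaleR_sum_right sum.Sigma)
  also have "\<dots> = (\<Sum>(j, k)\<in>Sigma {..n} (\<lambda>j. {..n - j}). (a k * w (n - j - k)) *\<^sub>R u j)"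
    by (rule sum.reindex_bij_witness[of _ "\<lambda>(j, k). (k, j)" "\<lambda>(k, j). (j, k)"])
       (auto simp: add.commute)
  also have "\<dots> = (\<Sum>j\<le>n. (\<Sum>k\<le>n - j. a k * w (n - j - k)) *\<^sub>R u j)"
    by (simp add: scaleR_sum_left sum.Sigma)
  also have "\<dots> = (\<Sum>j\<le>n. if j = n then u j else 0)"
    by (intro sum.cong) (auto simp: inv simp del: diff_diff_left)
  also have "\<dots> = u n" by simp
  finally show ?thesis .
qed

definition backward_diff :: "(nat \<Rightarrow> real) \<Rightarrow> nat \<Rightarrow> real" where
  "backward_diff a k = (if k = 0 then a 0 else a k - a (k - 1))"

text \<open>
  This form of the increment keeps the first term \<open>a\<^sub>0 y\<^sub>n\<close> whole, which is why \<open>backward_diff\<close>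
  treats the weight before the first one as zero.
\<close>

lemma convolution_diff:
  fixes y :: "nat \<Rightarrow> 'b::real_vector"
  assumes "n \<ge> 1"
  shows "(\<Sum>k\<le>n. a k *\<^sub>R y (n - k)) - (\<Sum>k\<le>n - 1. a k *\<^sub>R y (n - 1 - k))
       = (\<Sum>k\<le>n. backward_diff a k *\<^sub>R y (n - k))"
proof -
  obtain m where m: "n = Suc m" using assms by (cases n) auto
  show ?thesis
    unfolding m sum.atMost_Suc_shift
    by (simp add: backward_diff_def scaleR_left_diff_distrib sum_subtractf)
qed

text \<open>
  With \<open>b = backward_diff a\<close>, the inequality \<open>2 v\<^sub>n\<^sub>-\<^sub>k \<bullet> v\<^sub>n - v\<^sub>n\<^sub>-\<^sub>k \<bullet> v\<^sub>n\<^sub>-\<^sub>k \<le> v\<^sub>n \<bullet> v\<^sub>n\<close> is an equality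
  for \<open>k = 0\<close> and is multiplied by a nonpositive weight for \<open>k \<ge> 1\<close>. Summing up, the difference
  of the two sides is at least \<open>(\<Sum>k\<le>n. b\<^sub>k) (v\<^sub>n \<bullet> v\<^sub>n)\<close>, and this sum telescopes to \<open>a\<^sub>n \<ge> 0\<close>.
\<close>

lemma convolution_inner_ge:
  fixes v :: "nat \<Rightarrow> 'b::real_inner"
  assumes nonneg: "\<And>n. 0 \<le> a n" and decr: "\<And>n. a (Suc n) \<le> a n"
  shows "(\<Sum>k\<le>n. backward_diff a k * (v (n - k) \<bullet> v (n - k)))
       \<le> 2 * ((\<Sum>k\<le>n. backward_diff a k *\<^sub>R v (n - k)) \<bullet> v n)"
proof -
  define b where "b = backward_diff a"
  have "b k * (v n \<bullet> v n) \<le> b k * (2 * (v (n - k) \<bullet> v n) - v (n - k) \<bullet> v (n - k))" for k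
  proof (cases "k = 0")
    case False
    then have "b k \<le> 0" using decr[of "k - 1"] by (simp add: b_def backward_diff_def)
    moreover have "2 * (v (n - k) \<bullet> v n) - v (n - k) \<bullet> v (n - k) \<le> v n \<bullet> v n"
      using inner_ge_zero[of "v n - v (n - k)"] by (simp add: inner_diff inner_commute)
    ultimately show ?thesis by (intro mult_left_mono_neg)
  qed simp
  then have "(\<Sum>k\<le>n. b k) * (v n \<bullet> v n)
       \<le> (\<Sum>k\<le>n. b k * (2 * (v (n - k) \<bullet> v n) - v (n - k) \<bullet> v (n - k)))"
    unfolding sum_distrib_right by (intro sum_mono)
  moreover have "(\<Sum>k\<le>n. b k) = a n"
    by (induction n) (auto simp: b_def backward_diff_def)
  moreover have "0 \<le> a n * (v n \<bullet> v n)" using nonneg by simp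
  ultimately show ?thesis
    by (simp add: b_def inner_sum_left sum_distrib_left right_diff_distrib sum_subtractf mult.left_commute)
qed

section \<open>Square-integrable fields and the space of test fields\<close>

lemma L2_measurable: "f \<in> L2 \<Omega> \<Longrightarrow> f \<in> borel_measurable (lebesgue_on \<Omega>)"
  by (simp add: L2_def)

lemma L2_integrable_inner:
  assumes f: "f \<in> L2 \<Omega>" and g: "g \<in> L2 \<Omega>"
  shows "integrable (lebesgue_on \<Omega>) (\<lambda>x. f x \<bullet> g x)"
proof (rule Bochner_Integration.integrable_bound)
  show "integrable (lebesgue_on \<Omega>) (\<lambda>x. (norm (f x))\<^sup>2 + (norm (g x))\<^sup>2)"
    using f g by (simp add: L2_def)
  show "(\<lambda>x. f x \<bullet> g x) \<in> borel_measurable (lebesgue_on \<Omega>)"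
    using f g by (intro borel_measurable_inner L2_measurable)
  have "norm (f x \<bullet> g x) \<le> norm ((norm (f x))\<^sup>2 + (norm (g x))\<^sup>2)" for x
  proof -
    have "\<bar>f x \<bullet> g x\<bar> \<le> norm (f x) * norm (g x)" by (rule Cauchy_Schwarz_ineq2)
    also have "\<dots> \<le> 2 * norm (f x) * norm (g x)" by simp
    also have "\<dots> \<le> (norm (f x))\<^sup>2 + (norm (g x))\<^sup>2" by (rule sum_squares_bound)
    finally show ?thesis by simp
  qed
  then show "AE x in lebesgue_on \<Omega>. norm (f x \<bullet> g x) \<le> norm ((norm (f x))\<^sup>2 + (norm (g x))\<^sup>2)" by simp
qed

lemma L2_bounded_linear:
  assumes T: "bounded_linear T" and f: "f \<in> L2 \<Omega>"
  shows "(\<lambda>x. T (f x)) \<in> L2 \<Omega>"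
proof -
  obtain K where K: "\<And>x. norm (T x) \<le> norm x * K"
    using bounded_linear.bounded[OF T] by blast
  have "T \<in> borel_measurable borel"
    by (intro borel_measurable_continuous_onI linear_continuous_on T)
  then have meas: "(\<lambda>x. T (f x)) \<in> borel_measurable (lebesgue_on \<Omega>)"
    using L2_measurable[OF f] by measurable
  have "norm ((norm (T (f x)))\<^sup>2) \<le> norm (K\<^sup>2 * (norm (f x))\<^sup>2)" for x
    using power_mono[OF K norm_ge_zero, of "f x" 2] by (simp add: power_mult_distrib mult.commute)
  then have "integrable (lebesgue_on \<Omega>) (\<lambda>x. (norm (T (f x)))\<^sup>2)"
    using f meas
    by - (rule Bochner_Integration.integrable_bound[of _ "\<lambda>x. K\<^sup>2 * (norm (f x))\<^sup>2"], auto simp: L2_def)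
  then show ?thesis using meas by (simp add: L2_def)
qed

lemma L2_add:
  assumes f: "f \<in> L2 \<Omega>" and g: "g \<in> L2 \<Omega>"
  shows "(\<lambda>x. f x + g x) \<in> L2 \<Omega>"
proof -
  have "integrable (lebesgue_on \<Omega>) (\<lambda>x. f x \<bullet> f x + 2 * (f x \<bullet> g x) + g x \<bullet> g x)"
    by (intro Bochner_Integration.integrable_add integrable_mult_right L2_integrable_inner f g)
  then have "integrable (lebesgue_on \<Omega>) (\<lambda>x. (norm (f x + g x))\<^sup>2)"
    by (simp add: power2_norm_eq_inner inner_add inner_commute algebra_simps)
  moreover have "(\<lambda>x. f x + g x) \<in> borel_measurable (lebesgue_on \<Omega>)"
    using f g by (intro borel_measurable_add L2_measurable)
  ultimately show ?thesis
    by (simp add: L2_def)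
qed

lemma L2_scaleR: "f \<in> L2 \<Omega> \<Longrightarrow> (\<lambda>x. c *\<^sub>R f x) \<in> L2 \<Omega>"
  by (rule L2_bounded_linear[OF bounded_linear_scaleR_right])

lemma L2_diff: "f \<in> L2 \<Omega> \<Longrightarrow> g \<in> L2 \<Omega> \<Longrightarrow> (\<lambda>x. f x - g x) \<in> L2 \<Omega>"
  using L2_add[of f \<Omega> "\<lambda>x. (- 1) *\<^sub>R g x"] L2_scaleR[of g \<Omega> "- 1"] by simp

lemma L2_sum:
  assumes "finite I" "\<And>i. i \<in> I \<Longrightarrow> f i \<in> L2 \<Omega>"
  shows "(\<lambda>x. \<Sum>i\<in>I. f i x) \<in> L2 \<Omega>"
  using assms
proof (induction I rule: finite_induct)
  case empty
  show ?case by (simp add: L2_def)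
next
  case (insert i I)
  then have "(\<lambda>x. f i x + (\<Sum>i\<in>I. f i x)) \<in> L2 \<Omega>"
    by (intro L2_add) auto
  then show ?case using insert by simp
qed

lemmas L2_intros = L2_add L2_diff L2_scaleR L2_sum

lemma L2_inner_commute: "L2_inner \<Omega> f g = L2_inner \<Omega> g f"
  by (simp add: L2_inner_def inner_commute)

lemma L2_inner_add_left:
  "f \<in> L2 \<Omega> \<Longrightarrow> g \<in> L2 \<Omega> \<Longrightarrow> h \<in> L2 \<Omega> \<Longrightarrow>
    L2_inner \<Omega> (\<lambda>x. f x + g x) h = L2_inner \<Omega> f h + L2_inner \<Omega> g h"
  by (simp add: L2_inner_def inner_add_left L2_integrable_inner)

lemma L2_inner_scaleR_left: "L2_inner \<Omega> (\<lambda>x. c *\<^sub>R f x) h = c * L2_inner \<Omega> f h"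
  by (simp add: L2_inner_def)

lemma L2_inner_lincomb_left:
  "f \<in> L2 \<Omega> \<Longrightarrow> g \<in> L2 \<Omega> \<Longrightarrow> h \<in> L2 \<Omega> \<Longrightarrow>
    L2_inner \<Omega> (\<lambda>x. p *\<^sub>R f x + q *\<^sub>R g x) h = p * L2_inner \<Omega> f h + q * L2_inner \<Omega> g h"
  using L2_inner_add_left[of "\<lambda>x. p *\<^sub>R f x" \<Omega> "\<lambda>x. q *\<^sub>R g x" h]
  by (simp add: L2_inner_scaleR_left L2_scaleR)

lemma power2_L2_norm: "(L2_norm \<Omega> f)\<^sup>2 = L2_inner \<Omega> f f"
  by (simp add: L2_norm_def L2_inner_def)

text \<open>
  Together with the next lemma this makes every pairing with a test function an inner product of
  two square-integrable functions, so that weak derivatives are linear.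
\<close>

lemma continuous_imp_L2:
  fixes f :: "'a::euclidean_space \<Rightarrow> 'b::euclidean_space"
  assumes f: "continuous_on UNIV f" and \<Omega>: "bounded \<Omega>" "open \<Omega>"
  shows "f \<in> L2 \<Omega>"
proof -
  have meas: "f \<in> borel_measurable (lebesgue_on \<Omega>)"
    using \<Omega> by (intro continuous_imp_measurable_on_sets_lebesgue continuous_on_subset[OF f]) auto
  have "bounded (f ` closure \<Omega>)"
    using \<Omega> by (intro compact_imp_bounded compact_continuous_image continuous_on_subset[OF f]) auto
  then obtain B where B: "\<And>x. x \<in> closure \<Omega> \<Longrightarrow> norm (f x) \<le> B"
    by (auto simp: bounded_iff)
  interpret finite_measure "lebesgue_on \<Omega>"
    using \<Omega> by (intro finite_measure_lebesgue_on bounded_set_imp_lmeasurable) auto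
  have "AE x in lebesgue_on \<Omega>. norm ((norm (f x))\<^sup>2) \<le> B\<^sup>2"
    using B closure_subset[of \<Omega>] by (intro AE_I2) (auto intro!: power_mono)
  then have "integrable (lebesgue_on \<Omega>) (\<lambda>x. (norm (f x))\<^sup>2)"
    using meas by (intro integrable_const_bound) auto
  then show ?thesis using meas by (simp add: L2_def)
qed

lemma test_function_L2:
  assumes \<eta>: "\<eta> \<in> test_functions \<Omega>" and \<Omega>: "bounded \<Omega>" "open \<Omega>"
  shows "\<eta> \<in> L2 \<Omega>" and "e \<in> Basis \<Longrightarrow> pd e \<eta> \<in> L2 \<Omega>"
proof -
  have C: "C_k k \<eta>" for k using \<eta> by (simp add: test_functions_def)
  show "\<eta> \<in> L2 \<Omega>" using C[of 0] \<Omega> by (intro continuous_imp_L2) auto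
  show "e \<in> Basis \<Longrightarrow> pd e \<eta> \<in> L2 \<Omega>" using C[of "Suc 0"] \<Omega> by (intro continuous_imp_L2) auto
qed

lemma weak_curl_lincomb:
  assumes v: "v \<in> L2 \<Omega>" "v' \<in> L2 \<Omega>" and w: "w \<in> L2 \<Omega>" "w' \<in> L2 \<Omega>"
    and curl: "weak_curl \<Omega> v w" "weak_curl \<Omega> v' w'" and \<Omega>: "bounded \<Omega>" "open \<Omega>"
  shows "weak_curl \<Omega> (\<lambda>x. p *\<^sub>R v x + q *\<^sub>R v' x) (\<lambda>x. p *\<^sub>R w x + q *\<^sub>R w' x)"
  unfolding weak_curl_def
proof
  fix \<eta> assume \<eta>: "\<eta> \<in> test_functions \<Omega>"
  have "pd (1, 0) \<eta> \<in> L2 \<Omega>" "pd (0, 1) \<eta> \<in> L2 \<Omega>" "\<eta> \<in> L2 \<Omega>"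
    using test_function_L2[OF \<eta> \<Omega>] by (auto simp: Basis_prod_def)
  moreover have "(\<lambda>x. fst (v x)) \<in> L2 \<Omega>" "(\<lambda>x. fst (v' x)) \<in> L2 \<Omega>"
      "(\<lambda>x. snd (v x)) \<in> L2 \<Omega>" "(\<lambda>x. snd (v' x)) \<in> L2 \<Omega>"
    by (rule L2_bounded_linear[OF bounded_linear_fst] L2_bounded_linear[OF bounded_linear_snd], fact v)+
  ultimately show "L2_inner \<Omega> (\<lambda>x. p *\<^sub>R w x + q *\<^sub>R w' x) \<eta> =
        - L2_inner \<Omega> (\<lambda>x. snd (p *\<^sub>R v x + q *\<^sub>R v' x)) (pd (1, 0) \<eta>)
        + L2_inner \<Omega> (\<lambda>x. fst (p *\<^sub>R v x + q *\<^sub>R v' x)) (pd (0, 1) \<eta>)"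
    using curl[unfolded weak_curl_def, THEN bspec, OF \<eta>] w
    unfolding fst_add snd_add fst_scaleR snd_scaleR
    by (simp add: L2_inner_lincomb_left right_diff_distrib distrib_left del: real_scaleR_def)
qed

text \<open>
  The \<open>\<theta>\<close>-average of the electric field has to be an admissible test field. Linearity is checked
  on arbitrary weak curls that witness membership, so the choice of representative made by \<open>curl\<close>
  is immaterial.
\<close>

lemma H0curl_lincomb:
  assumes v: "v \<in> H0curl \<Omega>" "v' \<in> H0curl \<Omega>" and \<Omega>: "bounded \<Omega>" "open \<Omega>"
  shows "(\<lambda>x. p *\<^sub>R v x + q *\<^sub>R v' x) \<in> H0curl \<Omega>"
proof -
  obtain w where w: "w \<in> L2 \<Omega>" "weak_curl \<Omega> v w" "v \<in> L2 \<Omega>"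
    and tr: "\<And>\<phi> g. \<phi> \<in> L2 \<Omega> \<Longrightarrow> g \<in> L2 \<Omega> \<Longrightarrow> weak_grad \<Omega> \<phi> g \<Longrightarrow> tangential_trace \<Omega> v w \<phi> g = 0"
    using v(1) unfolding H0curl_def by blast
  obtain w' where w': "w' \<in> L2 \<Omega>" "weak_curl \<Omega> v' w'" "v' \<in> L2 \<Omega>"
    and tr': "\<And>\<phi> g. \<phi> \<in> L2 \<Omega> \<Longrightarrow> g \<in> L2 \<Omega> \<Longrightarrow> weak_grad \<Omega> \<phi> g \<Longrightarrow> tangential_trace \<Omega> v' w' \<phi> g = 0"
    using v(2) unfolding H0curl_def by blast
  have rot: "bounded_linear (\<lambda>z::real \<times> real. (snd z, - fst z))"
    by (intro bounded_linear_Pair bounded_linear_snd bounded_linear_minus bounded_linear_fst)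
  have "tangential_trace \<Omega> (\<lambda>x. p *\<^sub>R v x + q *\<^sub>R v' x) (\<lambda>x. p *\<^sub>R w x + q *\<^sub>R w' x) \<phi> g = 0"
    if "\<phi> \<in> L2 \<Omega>" "g \<in> L2 \<Omega>" "weak_grad \<Omega> \<phi> g" for \<phi> g
  proof -
    have "tangential_trace \<Omega> (\<lambda>x. p *\<^sub>R v x + q *\<^sub>R v' x) (\<lambda>x. p *\<^sub>R w x + q *\<^sub>R w' x) \<phi> g
        = p * tangential_trace \<Omega> v w \<phi> g + q * tangential_trace \<Omega> v' w' \<phi> g"
      using that w w' L2_bounded_linear[OF rot that(2)]
      by (simp add: tangential_trace_def L2_inner_lincomb_left algebra_simps del: real_scaleR_def)
    then show ?thesis using tr[OF that] tr'[OF that] by simp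
  qed
  moreover have "weak_curl \<Omega> (\<lambda>x. p *\<^sub>R v x + q *\<^sub>R v' x) (\<lambda>x. p *\<^sub>R w x + q *\<^sub>R w' x)"
    using w w' \<Omega> by (intro weak_curl_lincomb)
  moreover have "(\<lambda>x. p *\<^sub>R v x + q *\<^sub>R v' x) \<in> L2 \<Omega>" "(\<lambda>x. p *\<^sub>R w x + q *\<^sub>R w' x) \<in> L2 \<Omega>"
    using w w' by (auto intro!: L2_intros simp del: real_scaleR_def)
  ultimately show ?thesis unfolding H0curl_def by blast
qed

section \<open>Energy estimates\<close>

text \<open>
  The \<open>\<theta>\<close>-average is the midpoint plus \<open>(1/2 - \<theta>)\<close> times the increment of \<open>u\<close>. The midpoint
  produces exactly the difference of the squared norms, and the rest a nonnegative multiple of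
  the squared increment.
\<close>

lemma theta_avg_energy:
  assumes u: "\<And>m. u m \<in> L2 \<Omega>" and "\<theta> \<le> 1/2" "\<tau> > 0"
  shows "(L2_norm \<Omega> (u n))\<^sup>2 - (L2_norm \<Omega> (u (n - 1)))\<^sup>2
     \<le> 2 * \<tau> * L2_inner \<Omega> (diff_quot \<tau> u n) (theta_avg \<theta> u n)"
proof -
  have mem: "diff_quot \<tau> u n \<in> L2 \<Omega>" "theta_avg \<theta> u n \<in> L2 \<Omega>"
    unfolding diff_quot_def theta_avg_def by (intro L2_intros u)+
  have pw: "u n x \<bullet> u n x - u (n - 1) x \<bullet> u (n - 1) x \<le> 2 * \<tau> * (diff_quot \<tau> u n x \<bullet> theta_avg \<theta> u n x)" for x
  proof -
    have "2 * \<tau> * (diff_quot \<tau> u n x \<bullet> theta_avg \<theta> u n x)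
        = 2 * ((u n x - u (n - 1) x) \<bullet> theta_avg \<theta> u n x)"
      using assms(3) by (simp add: diff_quot_def)
    also have "\<dots> =
      u n x \<bullet> u n x - u (n - 1) x \<bullet> u (n - 1) x + (1 - 2 * \<theta>) * ((u n x - u (n - 1) x) \<bullet> (u n x - u (n - 1) x))"
      by (simp add: theta_avg_def inner_simps inner_commute algebra_simps)
    finally show ?thesis using assms(2) by simp
  qed
  have "(LINT x|lebesgue_on \<Omega>. u n x \<bullet> u n x - u (n - 1) x \<bullet> u (n - 1) x)
    \<le> (LINT x|lebesgue_on \<Omega>. 2 * \<tau> * (diff_quot \<tau> u n x \<bullet> theta_avg \<theta> u n x))"
  proof (rule integral_mono)
    show "integrable (lebesgue_on \<Omega>) (\<lambda>x. u n x \<bullet> u n x - u (n - 1) x \<bullet> u (n - 1) x)"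
      by (rule Bochner_Integration.integrable_diff; rule L2_integrable_inner; rule u)
    show "integrable (lebesgue_on \<Omega>) (\<lambda>x. 2 * \<tau> * (diff_quot \<tau> u n x \<bullet> theta_avg \<theta> u n x))"
      by (intro integrable_mult_right L2_integrable_inner mem)
  qed (rule pw)
  then show ?thesis
    by (simp add: power2_L2_norm L2_inner_def L2_integrable_inner u)
qed

text \<open>
  The term with \<open>j = 0\<close> vanishes; including it gives a convolution starting at \<open>0\<close>, to which the
  inversion formula applies.
\<close>

lemma frac_diff_eq_convolution:
  "frac_diff \<alpha> \<theta> \<tau> u n x = (\<tau> powr (- \<alpha>)) *\<^sub>R (\<Sum>j\<le>n. omega_wt \<alpha> \<theta> (n - j) *\<^sub>R (u j x - u 0 x))"
  by (simp add: frac_diff_def atMost_atLeast0 sum.atLeast_Suc_atMost)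

lemma frac_diff_inverse:
  assumes "0 < \<alpha>" "0 \<le> \<theta>" "0 < \<tau>"
  shows "(\<Sum>k\<le>n. a_wt \<alpha> \<theta> k *\<^sub>R frac_diff \<alpha> \<theta> \<tau> u (n - k) x) = (\<tau> powr (- \<alpha>)) *\<^sub>R (u n x - u 0 x)"
proof -
  have "(\<Sum>k\<le>n. a_wt \<alpha> \<theta> k *\<^sub>R frac_diff \<alpha> \<theta> \<tau> u (n - k) x)
      = (\<tau> powr (- \<alpha>)) *\<^sub>R (\<Sum>k\<le>n. a_wt \<alpha> \<theta> k *\<^sub>R
          (\<Sum>j\<le>n - k. omega_wt \<alpha> \<theta> (n - k - j) *\<^sub>R (u j x - u 0 x)))"
    by (simp add: frac_diff_eq_convolution scaleR_sum_right mult_ac)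
  also have "\<dots> = (\<tau> powr (- \<alpha>)) *\<^sub>R (u n x - u 0 x)"
    using convolution_inverse[OF a_wt_omega_wt_inverse[OF assms(1,2)], where u = "\<lambda>j. u j x - u 0 x"] by simp
  finally show ?thesis .
qed

lemma frac_diff_L2:
  assumes "\<And>m. u m \<in> L2 \<Omega>"
  shows "frac_diff \<alpha> \<theta> \<tau> u n \<in> L2 \<Omega>"
  unfolding frac_diff_def by (intro L2_intros assms) auto

text \<open>
  The discrete counterpart of differentiating a fractional integral: by inversion of the
  fractional difference, \<open>\<tau>\<close> times the difference quotient of \<open>u\<close> is a convolution of the
  fractional differences \<open>v\<close> with \<open>backward_diff (a_wt \<alpha> \<theta>)\<close>, and the left-hand side is the same
  convolution of their squared norms, both up to the factor \<open>\<tau>\<^sup>\<alpha>\<close>. The inequality between them holds at each point of \<open>\<Omega>\<close>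
  and is then integrated.
\<close>

lemma frac_int_energy:
  assumes \<alpha>: "0 < \<alpha>" "\<alpha> < 1" "\<alpha> / 2 \<le> \<theta>" and \<tau>: "0 < \<tau>" and u: "\<And>m. u m \<in> L2 \<Omega>" and n: "n \<ge> 1"
  defines "w \<equiv> \<lambda>m. (L2_norm \<Omega> (frac_diff \<alpha> \<theta> \<tau> u m))\<^sup>2"
  shows "frac_int \<alpha> \<theta> \<tau> w n - frac_int \<alpha> \<theta> \<tau> w (n - 1)
       \<le> 2 * \<tau> * L2_inner \<Omega> (frac_diff \<alpha> \<theta> \<tau> u n) (diff_quot \<tau> u n)"
proof -
  define v where "v = frac_diff \<alpha> \<theta> \<tau> u"
  define b where "b = backward_diff (a_wt \<alpha> \<theta>)"
  define D where "D = diff_quot \<tau> u n"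
  have \<theta>: "0 \<le> \<theta>" using \<alpha> by simp
  have v: "v m \<in> L2 \<Omega>" for m
    unfolding v_def by (intro frac_diff_L2 u)
  have D: "D \<in> L2 \<Omega>"
    unfolding D_def diff_quot_def by (intro L2_intros u)
  have incr: "\<tau> powr \<alpha> *\<^sub>R (\<Sum>k\<le>n. b k *\<^sub>R v (n - k) x) = \<tau> *\<^sub>R D x" for x
  proof -
    have "(\<Sum>k\<le>n. b k *\<^sub>R v (n - k) x) = (\<tau> powr (- \<alpha>)) *\<^sub>R (u n x - u (n - 1) x)"
      unfolding b_def v_def
      by (subst convolution_diff[OF n, symmetric])
         (simp add: frac_diff_inverse[OF \<alpha>(1) \<theta> \<tau>] scaleR_diff_right del: One_nat_def diff_diff_left)
    then show ?thesis
      using \<tau> by (simp add: D_def diff_quot_def powr_minus)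
  qed
  have pw: "\<tau> powr \<alpha> * (\<Sum>k\<le>n. b k * (v (n - k) x \<bullet> v (n - k) x)) \<le> 2 * \<tau> * (v n x \<bullet> D x)" for x
  proof -
    have "\<tau> powr \<alpha> * (\<Sum>k\<le>n. b k * (v (n - k) x \<bullet> v (n - k) x))
        \<le> \<tau> powr \<alpha> * (2 * ((\<Sum>k\<le>n. b k *\<^sub>R v (n - k) x) \<bullet> v n x))"
      using convolution_inner_ge[of "a_wt \<alpha> \<theta>" "\<lambda>m. v m x" n] a_wt_nonneg_decreasing[OF \<alpha>]
      by (intro mult_left_mono) (auto simp: b_def)
    also have "\<dots> = 2 * ((\<tau> powr \<alpha> *\<^sub>R (\<Sum>k\<le>n. b k *\<^sub>R v (n - k) x)) \<bullet> v n x)"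
      by simp
    also have "\<dots> = 2 * \<tau> * (v n x \<bullet> D x)"
      unfolding incr by (simp add: inner_commute)
    finally show ?thesis .
  qed
  have "frac_int \<alpha> \<theta> \<tau> w n - frac_int \<alpha> \<theta> \<tau> w (n - 1) = \<tau> powr \<alpha> * (\<Sum>k\<le>n. b k * w (n - k))"
    using convolution_diff[OF n, of "a_wt \<alpha> \<theta>" w]
    by (simp add: frac_int_def b_def atMost_atLeast0 flip: right_diff_distrib)
  also have "\<dots> = (LINT x|lebesgue_on \<Omega>. \<tau> powr \<alpha> * (\<Sum>k\<le>n. b k * (v (n - k) x \<bullet> v (n - k) x)))"
    by (simp add: w_def power2_L2_norm flip: v_def) (simp add: L2_inner_def L2_integrable_inner v)
  also have "\<dots> \<le> (LINT x|lebesgue_on \<Omega>. 2 * \<tau> * (v n x \<bullet> D x))"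
  proof (rule integral_mono)
    show "integrable (lebesgue_on \<Omega>) (\<lambda>x. \<tau> powr \<alpha> * (\<Sum>k\<le>n. b k * (v (n - k) x \<bullet> v (n - k) x)))"
      by (intro integrable_mult_right Bochner_Integration.integrable_sum L2_integrable_inner v)
    show "integrable (lebesgue_on \<Omega>) (\<lambda>x. 2 * \<tau> * (v n x \<bullet> D x))"
      by (intro integrable_mult_right L2_integrable_inner v D)
  qed (rule pw)
  also have "\<dots> = 2 * \<tau> * L2_inner \<Omega> (v n) D"
    by (simp add: L2_inner_def)
  finally show ?thesis by (simp add: v_def D_def)
qed

theorem theorem3p7:
  fixes a b c d \<alpha> \<theta> \<tau> \<epsilon>\<^sub>0 \<epsilon>\<^sub>i\<^sub>n\<^sub>f \<epsilon>\<^sub>s \<mu>\<^sub>0 \<tau>\<^sub>0 :: real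
    and \<Omega> :: "(real \<times> real) set"
    and E0 P0 :: "real \<times> real \<Rightarrow> real \<times> real"
    and H0 :: "real \<times> real \<Rightarrow> real"
    and E P :: "nat \<Rightarrow> real \<times> real \<Rightarrow> real \<times> real"
    and H :: "nat \<Rightarrow> real \<times> real \<Rightarrow> real"
  assumes "a < b" and "c < d" and "\<Omega> = {a<..<b} \<times> {c<..<d}"
    and "\<epsilon>\<^sub>0 > 0" and "\<epsilon>\<^sub>i\<^sub>n\<^sub>f > 0" and "\<epsilon>\<^sub>s > 0" and "\<mu>\<^sub>0 > 0" and "\<tau>\<^sub>0 > 0" and "\<epsilon>\<^sub>s > \<epsilon>\<^sub>i\<^sub>n\<^sub>f"
    and "0 < \<alpha>" and "\<alpha> < 1" and "\<alpha> / 2 \<le> \<theta>" and "\<theta> \<le> 1 / 2" and "\<tau> > 0"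
    and "E0 \<in> H0curl \<Omega>" and "H0 \<in> L2 \<Omega>" and "P0 \<in> L2 \<Omega>"
    and "E 0 = E0" and "H 0 = H0" and "P 0 = P0"
    and "\<And>n. n \<ge> 1 \<Longrightarrow> E n \<in> H0curl \<Omega>"
    and "\<And>n. n \<ge> 1 \<Longrightarrow> H n \<in> L2 \<Omega>"
    and "\<And>n. n \<ge> 1 \<Longrightarrow> P n \<in> L2 \<Omega>"
    and "\<And>n \<xi>. n \<ge> 1 \<Longrightarrow> \<xi> \<in> H0curl \<Omega> \<Longrightarrow>
           \<epsilon>\<^sub>0 * \<epsilon>\<^sub>i\<^sub>n\<^sub>f * L2_inner \<Omega> (diff_quot \<tau> E n) \<xi> + L2_inner \<Omega> (diff_quot \<tau> P n) \<xi>
           - L2_inner \<Omega> (theta_avg \<theta> H n) (curl \<Omega> \<xi>) = 0"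
    and "\<And>n \<phi>. n \<ge> 1 \<Longrightarrow> \<phi> \<in> L2 \<Omega> \<Longrightarrow>
           \<mu>\<^sub>0 * L2_inner \<Omega> (diff_quot \<tau> H n) \<phi>
           + L2_inner \<Omega> (curl \<Omega> (theta_avg \<theta> E n)) \<phi> = 0"
    and "\<And>n \<psi>. n \<ge> 1 \<Longrightarrow> \<psi> \<in> L2 \<Omega> \<Longrightarrow>
           \<tau>\<^sub>0 powr \<alpha> * L2_inner \<Omega> (frac_diff \<alpha> \<theta> \<tau> P n) \<psi>
           + L2_inner \<Omega> (theta_avg \<theta> P n) \<psi>
           - \<epsilon>\<^sub>0 * (\<epsilon>\<^sub>s - \<epsilon>\<^sub>i\<^sub>n\<^sub>f) * L2_inner \<Omega> (theta_avg \<theta> E n) \<psi> = 0"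
  shows "\<forall>n\<ge>1. energy \<Omega> \<alpha> \<theta> \<tau> \<epsilon>\<^sub>0 \<epsilon>\<^sub>i\<^sub>n\<^sub>f \<epsilon>\<^sub>s \<mu>\<^sub>0 \<tau>\<^sub>0 E H P n
                \<le> energy \<Omega> \<alpha> \<theta> \<tau> \<epsilon>\<^sub>0 \<epsilon>\<^sub>i\<^sub>n\<^sub>f \<epsilon>\<^sub>s \<mu>\<^sub>0 \<tau>\<^sub>0 E H P (n - 1)"
proof (intro allI impI)
  fix n :: nat assume n: "n \<ge> 1"
  note \<Omega> = assms(3) and pos = assms(4-9) and params = assms(10-14) and init = assms(15-20)
    and mem = assms(21-23) and eqE = assms(24) and eqH = assms(25) and eqP = assms(26)
  have Ereg: "E m \<in> H0curl \<Omega>" for m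
    using init mem(1) by (cases m) auto
  have Hreg: "H m \<in> L2 \<Omega>" for m
    using init mem(2) by (cases m) auto
  have Preg: "P m \<in> L2 \<Omega>" for m
    using init mem(3) by (cases m) auto
  have EL2: "E m \<in> L2 \<Omega>" for m
    using Ereg by (auto simp: H0curl_def)
  have \<Omega>': "bounded \<Omega>" "open \<Omega>"
    by (auto simp: \<Omega> intro!: bounded_Times open_Times)
  let ?E = "theta_avg \<theta> E n" and ?H = "theta_avg \<theta> H n" and ?P = "theta_avg \<theta> P n"
  let ?dE = "diff_quot \<tau> E n" and ?dH = "diff_quot \<tau> H n" and ?dP = "diff_quot \<tau> P n"
  let ?V = "frac_diff \<alpha> \<theta> \<tau> P n"
  let ?w = "\<lambda>m. (L2_norm \<Omega> (frac_diff \<alpha> \<theta> \<tau> P m))\<^sup>2"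
  define \<kappa> where "\<kappa> = \<epsilon>\<^sub>0 * (\<epsilon>\<^sub>s - \<epsilon>\<^sub>i\<^sub>n\<^sub>f)"
  have \<kappa>: "\<kappa> > 0" using pos by (simp add: \<kappa>_def)
  have Eavg: "?E \<in> H0curl \<Omega>"
    unfolding theta_avg_def by (intro H0curl_lincomb Ereg \<Omega>')
  have Havg: "?H \<in> L2 \<Omega>"
    unfolding theta_avg_def by (intro L2_intros Hreg)
  have dP: "?dP \<in> L2 \<Omega>"
    unfolding diff_quot_def by (intro L2_intros Preg)
  \<comment> \<open>Both equations contain the inner product of \<open>?H\<close> and \<open>curl \<Omega> ?E\<close>, with opposite signs.\<close>
  have "\<epsilon>\<^sub>0 * \<epsilon>\<^sub>i\<^sub>n\<^sub>f * L2_inner \<Omega> ?dE ?E + \<mu>\<^sub>0 * L2_inner \<Omega> ?dH ?H = - L2_inner \<Omega> ?E ?dP"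
    using eqE[OF n Eavg] eqH[OF n Havg]
    by (simp add: L2_inner_commute[of \<Omega> ?H] L2_inner_commute[of \<Omega> ?dP])
  then have "\<kappa> * (\<epsilon>\<^sub>0 * \<epsilon>\<^sub>i\<^sub>n\<^sub>f * L2_inner \<Omega> ?dE ?E + \<mu>\<^sub>0 * L2_inner \<Omega> ?dH ?H) = - (\<kappa> * L2_inner \<Omega> ?E ?dP)"
    by simp
  then have balance: "\<tau>\<^sub>0 powr \<alpha> * L2_inner \<Omega> ?V ?dP + L2_inner \<Omega> ?dP ?P
      + \<kappa> * (\<epsilon>\<^sub>0 * \<epsilon>\<^sub>i\<^sub>n\<^sub>f * L2_inner \<Omega> ?dE ?E + \<mu>\<^sub>0 * L2_inner \<Omega> ?dH ?H) = 0"
    using eqP[OF n dP] by (simp add: \<kappa>_def L2_inner_commute[of \<Omega> ?P])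
  have P: "(L2_norm \<Omega> (P n))\<^sup>2 - (L2_norm \<Omega> (P (n - 1)))\<^sup>2 \<le> 2 * \<tau> * L2_inner \<Omega> ?dP ?P"
    using params by (intro theta_avg_energy Preg) auto
  have "(L2_norm \<Omega> (E n))\<^sup>2 - (L2_norm \<Omega> (E (n - 1)))\<^sup>2 \<le> 2 * \<tau> * L2_inner \<Omega> ?dE ?E"
    using params by (intro theta_avg_energy EL2) auto
  then have EE: "\<kappa> * (\<epsilon>\<^sub>0 * \<epsilon>\<^sub>i\<^sub>n\<^sub>f) * ((L2_norm \<Omega> (E n))\<^sup>2 - (L2_norm \<Omega> (E (n - 1)))\<^sup>2)
      \<le> \<kappa> * (\<epsilon>\<^sub>0 * \<epsilon>\<^sub>i\<^sub>n\<^sub>f) * (2 * \<tau> * L2_inner \<Omega> ?dE ?E)"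
    using \<kappa> pos by (intro mult_left_mono) auto
  have "(L2_norm \<Omega> (H n))\<^sup>2 - (L2_norm \<Omega> (H (n - 1)))\<^sup>2 \<le> 2 * \<tau> * L2_inner \<Omega> ?dH ?H"
    using params by (intro theta_avg_energy Hreg) auto
  then have HH: "\<kappa> * \<mu>\<^sub>0 * ((L2_norm \<Omega> (H n))\<^sup>2 - (L2_norm \<Omega> (H (n - 1)))\<^sup>2)
      \<le> \<kappa> * \<mu>\<^sub>0 * (2 * \<tau> * L2_inner \<Omega> ?dH ?H)"
    using \<kappa> pos by (intro mult_left_mono) auto
  have "frac_int \<alpha> \<theta> \<tau> ?w n - frac_int \<alpha> \<theta> \<tau> ?w (n - 1) \<le> 2 * \<tau> * L2_inner \<Omega> ?V ?dP"
    using params n by (intro frac_int_energy Preg) auto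
  then have V: "\<tau>\<^sub>0 powr \<alpha> * (frac_int \<alpha> \<theta> \<tau> ?w n - frac_int \<alpha> \<theta> \<tau> ?w (n - 1))
      \<le> \<tau>\<^sub>0 powr \<alpha> * (2 * \<tau> * L2_inner \<Omega> ?V ?dP)"
    by (intro mult_left_mono) auto
  let ?en = "energy \<Omega> \<alpha> \<theta> \<tau> \<epsilon>\<^sub>0 \<epsilon>\<^sub>i\<^sub>n\<^sub>f \<epsilon>\<^sub>s \<mu>\<^sub>0 \<tau>\<^sub>0 E H P"
  have "?en n - ?en (n - 1)
      = \<tau>\<^sub>0 powr \<alpha> * (frac_int \<alpha> \<theta> \<tau> ?w n - frac_int \<alpha> \<theta> \<tau> ?w (n - 1))
        + ((L2_norm \<Omega> (P n))\<^sup>2 - (L2_norm \<Omega> (P (n - 1)))\<^sup>2)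
        + \<kappa> * (\<epsilon>\<^sub>0 * \<epsilon>\<^sub>i\<^sub>n\<^sub>f) * ((L2_norm \<Omega> (E n))\<^sup>2 - (L2_norm \<Omega> (E (n - 1)))\<^sup>2)
        + \<kappa> * \<mu>\<^sub>0 * ((L2_norm \<Omega> (H n))\<^sup>2 - (L2_norm \<Omega> (H (n - 1)))\<^sup>2)"
    unfolding energy_def \<kappa>_def[symmetric] by (simp only: right_diff_distrib distrib_left mult.assoc)
  also have "\<dots> \<le> \<tau>\<^sub>0 powr \<alpha> * (2 * \<tau> * L2_inner \<Omega> ?V ?dP) + 2 * \<tau> * L2_inner \<Omega> ?dP ?P
        + \<kappa> * (\<epsilon>\<^sub>0 * \<epsilon>\<^sub>i\<^sub>n\<^sub>f) * (2 * \<tau> * L2_inner \<Omega> ?dE ?E) + \<kappa> * \<mu>\<^sub>0 * (2 * \<tau> * L2_inner \<Omega> ?dH ?H)"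
    by (intro add_mono V P EE HH)
  also have "\<dots> = 2 * \<tau> * (\<tau>\<^sub>0 powr \<alpha> * L2_inner \<Omega> ?V ?dP + L2_inner \<Omega> ?dP ?P
      + \<kappa> * (\<epsilon>\<^sub>0 * \<epsilon>\<^sub>i\<^sub>n\<^sub>f * L2_inner \<Omega> ?dE ?E + \<mu>\<^sub>0 * L2_inner \<Omega> ?dH ?H))"
    by (simp add: distrib_left mult_ac)
  also have "\<dots> = 0" unfolding balance by simp
  finally show "?en n \<le> ?en (n - 1)" by simp
qed

end
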